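(* Let $k$ be a positive integer and let $\alpha_k$ be the unique positive root of $f_k(x)=\sum_{i=0}^{k-1}(k-i)\frac{x^i}{i!}-xe^x$. Then w.h.p. $\tau'(\mathcal D_k,n)=(\alpha_k+o(1))n$.
   Context: Semi-random multigraph process: fix $n$ and start with the empty multigraph on vertex set $[n]$. In each round $t=1,2,\dots$, a vertex $v_t$ is chosen uniformly at random from $[n]$, independently of all previous rounds; Builder then chooses a vertex $u_t\in[n]$ (possibly $u_t=v_t$) and adds the edge $u_tv_t$ (loops and multiple edges allowed). In the offline version, Builder is given the entire sequence $(v_t)_{t\ge1}$ before the game starts, so his (possibly randomized) strategy may choose $u_t$ depending on the whole sequence. For a strategy $\mathcal S$ let $G_m$ be Builder's multigraph after $m$ rounds. For a monotone increasing property $\mathcal P$ and $0\le p\le1$, $\tau'_p(\mathcal S)$ is the least $m$ with $\Pr(G_m\in\mathcal P)\ge p$ and $\tau'_p(\mathcal P,n)=\min_{\mathcal S}\tau'_p(\mathcal S)$. "W.h.p. $\tau'(\mathcal P,n)=(c+o(1))n$" means that for every fixed $\delta>0$: $\tau'_{1-o(1)}(\mathcal P,n)\le (c+\delta)n$ (some strategy achieves $\mathcal P$ within $(c+\delta)n$ rounds with probability $1-o(1)$) and $\tau'_{o(1)}(\mathcal P,n)\ge (c-\delta)n$ (for every strategy, w.h.p. $\mathcal P$ fails after $(c-\delta)n$ rounds). $\mathcal D_k$ is the property that every vertex has at least $k$ distinct neighbours other than itself (degrees computed ignoring loops and edge multiplicities). *)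

theory Defs
  imports "HOL-Probability.Probability" "HOL-Library.Uprod"
begin

text \<open>
  A multigraph on \<open>{1..n}\<close> is a multiset of unordered pairs; the pair \<open>Upair x x\<close> is a loop.
\<close>

type_synonym multigraph = "nat uprod multiset"

definition choice_space :: "nat \<Rightarrow> (nat \<Rightarrow> nat) measure" where
  "choice_space n = (\<Pi>\<^sub>M t\<in>{1..}. count_space {1..n})"

definition vertex_law :: "nat \<Rightarrow> (nat \<Rightarrow> nat) measure" where
  "vertex_law n = (\<Pi>\<^sub>M t\<in>{1..}. uniform_count_measure {1..n})"

text \<open>
  A randomized offline strategy is a probability kernel: it turns the entire sequence
  \<open>v\<^sub>1, v\<^sub>2, \<dots>\<close> into a distribution on the sequence of answers \<open>u\<^sub>1, u\<^sub>2, \<dots>\<close>.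
\<close>

definition offline_strategies :: "nat \<Rightarrow> ((nat \<Rightarrow> nat) \<Rightarrow> (nat \<Rightarrow> nat) measure) set" where
  "offline_strategies n = vertex_law n \<rightarrow>\<^sub>M prob_algebra (choice_space n)"

definition game_law ::
    "nat \<Rightarrow> ((nat \<Rightarrow> nat) \<Rightarrow> (nat \<Rightarrow> nat) measure) \<Rightarrow> ((nat \<Rightarrow> nat) \<times> (nat \<Rightarrow> nat)) measure" where
  "game_law n S =
     do {
       v \<leftarrow> vertex_law n;
       u \<leftarrow> S v;
       return (vertex_law n \<Otimes>\<^sub>M choice_space n) (v, u)
     }"

definition builder_graph :: "nat \<Rightarrow> (nat \<Rightarrow> nat) \<times> (nat \<Rightarrow> nat) \<Rightarrow> multigraph" where
  "builder_graph m = (\<lambda>(v, u). {# Upair (u t) (v t). t \<in># mset_set {1..m} #})"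

definition success_prob ::
    "nat \<Rightarrow> multigraph set \<Rightarrow> ((nat \<Rightarrow> nat) \<Rightarrow> (nat \<Rightarrow> nat) measure) \<Rightarrow> nat \<Rightarrow> real" where
  "success_prob n \<P> S m =
     measure (game_law n S) {\<omega> \<in> space (game_law n S). builder_graph m \<omega> \<in> \<P>}"

text \<open>
  Both minima are taken in \<^typ>\<open>enat\<close>, where the infimum of a nonempty set is attained and the
  infimum of the empty set is \<open>\<infinity>\<close>. A graph property \<open>\<P>\<close> assigns to each \<open>n\<close> a set of
  multigraphs on \<open>{1..n}\<close>.
\<close>

definition tau_strategy ::
    "real \<Rightarrow> nat \<Rightarrow> multigraph set \<Rightarrow> ((nat \<Rightarrow> nat) \<Rightarrow> (nat \<Rightarrow> nat) measure) \<Rightarrow> enat" where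
  "tau_strategy p n \<P> S = Inf {enat m | m. success_prob n \<P> S m \<ge> p}"

definition tau_offline :: "real \<Rightarrow> (nat \<Rightarrow> multigraph set) \<Rightarrow> nat \<Rightarrow> enat" where
  "tau_offline p \<P> n = (INF S \<in> offline_strategies n. tau_strategy p n (\<P> n) S)"

text \<open>
  W.h.p. \<open>\<tau>'(\<P>, n) = (c + o(1)) n\<close>. The subscripts \<open>1 - o(1)\<close> and \<open>o(1)\<close> are rendered by
  sequences \<open>\<epsilon>\<close> tending to \<open>0\<close>; these may depend on \<open>\<delta>\<close>.
\<close>

definition whp_tau_offline :: "(nat \<Rightarrow> multigraph set) \<Rightarrow> real \<Rightarrow> bool" where
  "whp_tau_offline \<P> c \<longleftrightarrow>
     (\<forall>\<delta>>0.
        (\<exists>\<epsilon> :: nat \<Rightarrow> real. range \<epsilon> \<subseteq> {0..1} \<and> \<epsilon> \<longlonglongrightarrow> 0 \<and>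
           (\<forall>\<^sub>F n in sequentially.
              ereal_of_enat (tau_offline (1 - \<epsilon> n) \<P> n) \<le> ereal ((c + \<delta>) * real n))) \<and>
        (\<exists>\<epsilon> :: nat \<Rightarrow> real. range \<epsilon> \<subseteq> {0..1} \<and> \<epsilon> \<longlonglongrightarrow> 0 \<and>
           (\<forall>\<^sub>F n in sequentially.
              ereal_of_enat (tau_offline (\<epsilon> n) \<P> n) \<ge> ereal ((c - \<delta>) * real n))))"

definition neighbours :: "nat \<Rightarrow> multigraph \<Rightarrow> nat \<Rightarrow> nat set" where
  "neighbours n G x = {y \<in> {1..n}. y \<noteq> x \<and> Upair x y \<in># G}"

definition min_degree_property :: "nat \<Rightarrow> nat \<Rightarrow> multigraph set" where
  "min_degree_property k n = {G. \<forall>x\<in>{1..n}. card (neighbours n G x) \<ge> k}"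

lemma min_degree_property_mono:
  assumes "G \<in> min_degree_property k n" "G \<subseteq># H"
  shows "H \<in> min_degree_property k n"
proof -
  have "card (neighbours n G x) \<le> card (neighbours n H x)" for x
    using mset_subset_eqD[OF assms(2)]
    by (intro card_mono) (auto simp: neighbours_def)
  with assms(1) show ?thesis
    by (fastforce simp: min_degree_property_def intro: order_trans)
qed

definition f_root :: "nat \<Rightarrow> real \<Rightarrow> real" where
  "f_root k x = (\<Sum>i<k. real (k - i) * (x ^ i / fact i)) - x * exp x"

definition alpha :: "nat \<Rightarrow> real" where
  "alpha k = (THE x. x > 0 \<and> f_root k x = 0)"

end

theory Submission
  imports Defs "HOL-Real_Asymp.Real_Asymp"
begin

text \<open>
  Let \<open>d x\<close> be the number of rounds among the first \<open>m\<close> that offer the vertex \<open>x\<close>, and call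
  \<open>\<Sum>x. max (k - d x) 0\<close> the deficiency. A vertex \<open>x\<close> can have degree \<open>k\<close> only if Builder chooses
  it at least \<open>k - d x\<close> times, so success forces the deficiency to be at most \<open>m\<close>. Conversely, a
  greedy choice of answers succeeds for \<open>n > k\<close> as soon as the deficiency is at most \<open>m - \<eta> n\<close> and no vertex
  is offered more than \<open>\<eta> n / k\<close> times. For \<open>m = \<lfloor>c n\<rfloor>\<close> the counts are asymptotically Poisson
  with mean \<open>c\<close>, and by an Efron--Stein bound and Chebyshev's inequality the deficiency divided by
  \<open>n\<close> concentrates at \<open>e\<^sup>-\<^sup>c (\<Sum>i<k. (k - i) c\<^sup>i / i!) = c + e\<^sup>-\<^sup>c f\<^sub>k(c)\<close>. Since
  \<open>e\<^sup>-\<^sup>c f\<^sub>k(c)\<close> is strictly decreasing in \<open>c\<close>, the threshold is its zero \<open>\<alpha>\<^sub>k\<close>.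
\<close>

section \<open>Deficiency and greedy answers\<close>

text \<open>The set \<open>R\<close> of rounds is arbitrary, because the greedy construction uses up
  rounds in no fixed order.\<close>

definition occurrences :: "nat set \<Rightarrow> (nat \<Rightarrow> nat) \<Rightarrow> nat \<Rightarrow> nat" where
  "occurrences R v x = card {t \<in> R. v t = x}"

text \<open>Degrees ignore multiplicities, so a plain set of edges suffices and the induction can
  insert edges one by one.\<close>

definition nbrs :: "nat \<Rightarrow> nat uprod set \<Rightarrow> nat \<Rightarrow> nat set" where
  "nbrs n E x = {y \<in> {1..n}. y \<noteq> x \<and> Upair x y \<in> E}"

definition deficiency :: "nat \<Rightarrow> nat \<Rightarrow> (nat \<Rightarrow> nat) \<Rightarrow> nat" where
  "deficiency k n d = (\<Sum>x\<in>{1..n}. k - d x)"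

lemma neighbours_builder_graph:
  "neighbours n (builder_graph m (v, u)) x = nbrs n ((\<lambda>t. Upair (u t) (v t)) ` {1..m}) x"
  by (simp add: neighbours_def nbrs_def builder_graph_def)

lemma finite_nbrs [simp]: "finite (nbrs n E x)"
  by (simp add: nbrs_def)

lemma nbrs_mono: "E \<subseteq> E' \<Longrightarrow> nbrs n E x \<subseteq> nbrs n E' x"
  by (auto simp: nbrs_def)

lemma card_nbrs_insert_ge: "card (nbrs n E x) \<le> card (nbrs n (insert e E) x)"
  by (intro card_mono nbrs_mono) auto

lemma card_nbrs_insert_new:
  assumes "y \<in> {1..n}" "y \<noteq> x" "y \<notin> nbrs n E x"
  shows "card (nbrs n (insert (Upair x y) E) x) = Suc (card (nbrs n E x))"
proof -
  have "nbrs n (insert (Upair x y) E) x = insert y (nbrs n E x)"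
    using assms by (auto simp: nbrs_def)
  then show ?thesis using assms by simp
qed

lemma nbrs_sym: "x \<in> {1..n} \<Longrightarrow> y \<in> nbrs n E x \<longleftrightarrow> y \<in> {1..n} \<and> x \<in> nbrs n E y"
  by (auto simp: nbrs_def Upair_inject insert_commute) (metis Upair_inject)+

lemma occurrences_remove:
  assumes "finite R" "t \<in> R"
  shows "occurrences R v x = occurrences (R - {t}) v x + of_bool (v t = x)"
proof -
  have "{s \<in> R. v s = x} = (if v t = x then insert t {s \<in> R - {t}. v s = x} else {s \<in> R - {t}. v s = x})"
    using assms by auto
  then show ?thesis using assms by (auto simp: occurrences_def)
qed

lemma card_hits_le:
  assumes "finite R" "finite B" "\<And>x. occurrences R v x \<le> \<Delta>"
  shows "card {t \<in> R. v t \<in> B} \<le> card B * \<Delta>"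
proof -
  have "card {t \<in> R. v t \<in> B} = card (\<Union>x\<in>B. {t \<in> R. v t = x})"
    by (rule arg_cong[of _ _ card]) auto
  also have "\<dots> \<le> (\<Sum>x\<in>B. card {t \<in> R. v t = x})"
    using assms by (intro card_UN_le) auto
  also have "\<dots> \<le> (\<Sum>x\<in>B. \<Delta>)"
    using assms by (intro sum_mono) (auto simp: occurrences_def)
  finally show ?thesis by simp
qed

text \<open>
  While some vertex \<open>x\<close> cannot reach degree \<open>k\<close> with its own unused rounds, an unused round offering
  a vertex that is not yet adjacent to \<open>x\<close> is spent on \<open>x\<close>. This lowers the deficiency and the number
  of unused rounds by one each, and such a round exists because at most \<open>k * \<Delta>\<close> rounds are unsuitable.
  After that, the owners of the remaining rounds pick new neighbours for themselves.
\<close>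

lemma greedy_completion:
  assumes "finite R" "\<And>t. t \<in> R \<Longrightarrow> v t \<in> {1..n}" "k < n"
    and "\<And>x. occurrences R v x \<le> \<Delta>"
    and "\<And>D. D = deficiency k n (\<lambda>x. card (nbrs n E x) + occurrences R v x) \<Longrightarrow>
           D = 0 \<or> D + k * \<Delta> \<le> card R"
  shows "\<exists>u. (\<forall>t\<in>R. u t \<in> {1..n}) \<and>
             (\<forall>x\<in>{1..n}. k \<le> card (nbrs n (E \<union> (\<lambda>t. Upair (u t) (v t)) ` R) x))"
  using assms
proof (induction "card R" arbitrary: R E)
  case 0
  then have "R = {}" by simp
  with 0(6)[OF refl] show ?case
    by (auto simp: deficiency_def occurrences_def)
next
  case (Suc r)
  note fin = \<open>finite R\<close> and vR = Suc.prems(2) and kn = \<open>k < n\<close> and \<Delta> = Suc.prems(4)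
    and D = Suc.prems(5)[OF refl]
  let ?A = "\<lambda>R E x. card (nbrs n E x) + occurrences R v x"
  \<comment> \<open>Answering round \<open>t\<close> with \<open>w\<close> leaves an instance with
    one round fewer; its answers are then extended by \<open>u(t := w)\<close>.\<close>
  have step: ?case if t: "t \<in> R" and w: "w \<in> {1..n}"
    and c: "\<And>D. D = deficiency k n (?A (R - {t}) (insert (Upair w (v t)) E)) \<Longrightarrow>
        D = 0 \<or> D + k * \<Delta> \<le> r" for t w
  proof -
    have card: "card (R - {t}) = r" using Suc.hyps(2) t fin by simp
    have "\<exists>u. (\<forall>s\<in>R - {t}. u s \<in> {1..n}) \<and>
        (\<forall>x\<in>{1..n}. k \<le> card (nbrs n (insert (Upair w (v t)) E \<union> (\<lambda>s. Upair (u s) (v s)) ` (R - {t})) x))"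
    proof (rule Suc.hyps(1))
      show "occurrences (R - {t}) v x \<le> \<Delta>" for x
        using \<Delta>[of x] occurrences_remove[OF fin t, of v x] by simp
    qed (use card fin vR kn c in auto)
    then obtain u where u: "\<And>s. s \<in> R - {t} \<Longrightarrow> u s \<in> {1..n}"
      "\<And>x. x \<in> {1..n} \<Longrightarrow> k \<le> card (nbrs n (insert (Upair w (v t)) E \<union> (\<lambda>s. Upair (u s) (v s)) ` (R - {t})) x)"
      by blast
    have "(\<lambda>s. Upair ((u(t := w)) s) (v s)) ` insert t (R - {t}) =
          insert (Upair w (v t)) ((\<lambda>s. Upair (u s) (v s)) ` (R - {t}))"
      unfolding image_insert by (intro arg_cong2[of _ _ _ _ insert] image_cong) auto
    then have "insert (Upair w (v t)) E \<union> (\<lambda>s. Upair (u s) (v s)) ` (R - {t}) =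
          E \<union> (\<lambda>s. Upair ((u(t := w)) s) (v s)) ` R"
      unfolding insert_Diff[OF t] by simp
    with u w t show ?case by (intro exI[of _ "u(t := w)"]) auto
  qed
  show ?case
  proof (cases "deficiency k n (?A R E) = 0")
    case True
    then have A: "k \<le> ?A R E x" if "x \<in> {1..n}" for x
      using that by (auto simp: deficiency_def)
    obtain t where t: "t \<in> R" using Suc.hyps(2) by fastforce
    define y where "y = v t"
    have y: "y \<in> {1..n}" using vR[OF t] by (simp add: y_def)
    \<comment> \<open>If the owner \<open>y\<close> of the round already has degree
      \<open>k\<close>, any answer will do, even a loop. Otherwise \<open>y\<close> and its
      neighbours number at most \<open>k < n\<close>, so a new neighbour exists and makes up for the
      used round.\<close>
    obtain w where w: "w \<in> {1..n}" and wy: "k \<le> card (nbrs n E y) \<or> (w \<noteq> y \<and> w \<notin> nbrs n E y)"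
    proof (cases "k \<le> card (nbrs n E y)")
      case False
      have "card (insert y (nbrs n E y)) < card {1..n}"
        using False kn by (auto simp: card_insert_if)
      then have "\<exists>w\<in>{1..n}. w \<notin> insert y (nbrs n E y)"
        by (meson card_mono finite_insert finite_nbrs leD subsetI)
      then show ?thesis using that by auto
    qed (use y that in auto)
    have "k \<le> ?A (R - {t}) (insert (Upair w (v t)) E) x" if x: "x \<in> {1..n}" for x
    proof (cases "x = y")
      case True
      have *: "Upair w (v t) = Upair y w" by (auto simp: y_def)
      have "occurrences R v y = Suc (occurrences (R - {t}) v y)"
        using occurrences_remove[OF fin t, of v y] by (simp add: y_def)
      then show ?thesis
        using wy A[OF x] card_nbrs_insert_ge[of n E y "Upair y w"] card_nbrs_insert_new[of w n y E] w
        unfolding * True by force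
    next
      case False
      then show ?thesis
        using A[OF x] card_nbrs_insert_ge[of n E x "Upair w (v t)"] occurrences_remove[OF fin t, of v x]
        by (simp add: y_def)
    qed
    then have "deficiency k n (?A (R - {t}) (insert (Upair w (v t)) E)) = 0"
      by (auto simp: deficiency_def)
    with t w show ?thesis by (intro step) auto
  next
    case False
    with D have D: "deficiency k n (?A R E) + k * \<Delta> \<le> card R" by simp
    from False obtain x where x: "x \<in> {1..n}" "?A R E x < k"
      by (auto simp: deficiency_def)
    have "card {t \<in> R. v t \<in> insert x (nbrs n E x)} \<le> card (insert x (nbrs n E x)) * \<Delta>"
      using fin \<Delta> by (intro card_hits_le) auto
    \<comment> \<open>Fewer than \<open>k\<close> neighbours together with \<open>x\<close> itself
      make at most \<open>k\<close> forbidden vertices. Since the deficiency is positive, the slack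
      in \<open>D\<close> makes the next bound strict.\<close>
    also have "\<dots> \<le> k * \<Delta>"
      using x(2) by (intro mult_right_mono) (auto simp: card_insert_if)
    also have "\<dots> < card R" using D False by simp
    finally have "\<exists>t\<in>R. v t \<notin> insert x (nbrs n E x)"
      by (metis (no_types, lifting) Collect_mem_eq Collect_cong nat_less_le)
    then obtain t where t: "t \<in> R" "v t \<noteq> x" "v t \<notin> nbrs n E x" by auto
    define y where "y = v t"
    let ?E' = "insert (Upair x y) E"
    have y: "y \<in> {1..n}" using vR[OF t(1)] by (simp add: y_def)
    have sym: "Upair x y = Upair y x" by auto
    have nx: "card (nbrs n ?E' x) = Suc (card (nbrs n E x))"
      using t y by (intro card_nbrs_insert_new) (auto simp: y_def)
    have ny: "card (nbrs n ?E' y) = Suc (card (nbrs n E y))"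
      unfolding sym using t y x nbrs_sym[OF y, of x E]
      by (intro card_nbrs_insert_new) (auto simp: y_def)
    have le: "?A R E z \<le> ?A (R - {t}) ?E' z" for z
      using ny card_nbrs_insert_ge[of n E z "Upair x y"] occurrences_remove[OF fin t(1), of v z]
      by (cases "z = y") (auto simp: y_def)
    have lt: "?A R E x < ?A (R - {t}) ?E' x"
      using nx t occurrences_remove[OF fin t(1), of v x] by (auto simp: y_def)
    have "deficiency k n (?A (R - {t}) ?E') < deficiency k n (?A R E)"
      unfolding deficiency_def
    proof (rule sum_strict_mono_ex1)
      show "\<forall>z\<in>{1..n}. k - ?A (R - {t}) ?E' z \<le> k - ?A R E z"
        using le by (auto intro!: diff_le_mono2)
      show "\<exists>z\<in>{1..n}. k - ?A (R - {t}) ?E' z < k - ?A R E z"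
        using x lt by (intro bexI[of _ x]) auto
    qed simp
    with D Suc.hyps(2) show ?thesis
      using t x by (intro step[of t x]) (auto simp: y_def)
  qed
qed

lemma exists_answers:
  assumes "\<And>t. t \<in> {1..m} \<Longrightarrow> v t \<in> {1..n}" "k < n"
    and "\<And>x. x \<in> {1..n} \<Longrightarrow> occurrences {1..m} v x \<le> \<Delta>"
    and "deficiency k n (occurrences {1..m} v) + k * \<Delta> \<le> m"
  shows "\<exists>u. (\<forall>t\<in>{1..m}. u t \<in> {1..n}) \<and> builder_graph m (v, u) \<in> min_degree_property k n"
proof -
  have "occurrences {1..m} v x \<le> \<Delta>" for x
  proof (cases "x \<in> {1..n}")
    case False
    then have "{t \<in> {1..m}. v t = x} = {}" using assms(1) by auto
    then show ?thesis by (simp only: occurrences_def) simp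
  qed (use assms in auto)
  then have "\<exists>u. (\<forall>t\<in>{1..m}. u t \<in> {1..n}) \<and>
       (\<forall>x\<in>{1..n}. k \<le> card (nbrs n ({} \<union> (\<lambda>t. Upair (u t) (v t)) ` {1..m}) x))"
    using assms by (intro greedy_completion) (auto simp: nbrs_def)
  then show ?thesis
    by (auto simp: min_degree_property_def neighbours_builder_graph)
qed

text \<open>Each neighbour of \<open>x\<close> comes from a round that offers \<open>x\<close> or
  from one that Builder answers with \<open>x\<close>. The first kind gives at most
  \<open>occurrences {1..m} v x\<close> neighbours, and summing the second kind over
  \<open>x\<close> counts every round at most once.\<close>

lemma deficiency_le_rounds:
  assumes "builder_graph m (v, u) \<in> min_degree_property k n"
  shows "deficiency k n (occurrences {1..m} v) \<le> m"
proof -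
  have "k - occurrences {1..m} v x \<le> card {t \<in> {1..m}. u t = x}" if x: "x \<in> {1..n}" for x
  proof -
    have "k \<le> card (nbrs n ((\<lambda>t. Upair (u t) (v t)) ` {1..m}) x)"
      using assms x by (auto simp: min_degree_property_def neighbours_builder_graph)
    also have "\<dots> \<le> card (u ` {t \<in> {1..m}. v t = x} \<union> v ` {t \<in> {1..m}. u t = x})"
      by (intro card_mono) (auto simp: nbrs_def)
    also have "\<dots> \<le> card (u ` {t \<in> {1..m}. v t = x}) + card (v ` {t \<in> {1..m}. u t = x})"
      by (rule card_Un_le)
    also have "\<dots> \<le> occurrences {1..m} v x + card {t \<in> {1..m}. u t = x}"
      unfolding occurrences_def by (intro add_mono card_image_le) auto
    finally show ?thesis by simp
  qed
  then have "deficiency k n (occurrences {1..m} v) \<le> (\<Sum>x\<in>{1..n}. card {t \<in> {1..m}. u t = x})"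
    unfolding deficiency_def by (intro sum_mono)
  also have "\<dots> = card (\<Union>x\<in>{1..n}. {t \<in> {1..m}. u t = x})"
    by (subst card_UN_disjoint) auto
  also have "\<dots> \<le> card {1..m}" by (intro card_mono) auto
  finally show ?thesis by simp
qed

text \<open>This lets a single large deficiency at a late round rule out success at all earlier
  rounds.\<close>

lemma deficiency_occurrences_antimono:
  assumes "m \<le> m'"
  shows "deficiency k n (occurrences {1..m'} v) \<le> deficiency k n (occurrences {1..m} v)"
proof -
  have "occurrences {1..m} v x \<le> occurrences {1..m'} v x" for x
    unfolding occurrences_def using assms by (intro card_mono) auto
  then show ?thesis unfolding deficiency_def by (intro sum_mono diff_le_mono2)
qed

section \<open>Binomial and Poisson deficits\<close>

text \<open>This is the mean of \<open>max (k - X) 0\<close> for a Poisson variable \<open>X\<close>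
  with mean \<open>x\<close>.\<close>

definition poisson_deficit :: "nat \<Rightarrow> real \<Rightarrow> real" where
  "poisson_deficit k x = exp (- x) * (\<Sum>i<k. real (k - i) * (x ^ i / fact i))"

text \<open>The roots of \<open>f_root k\<close> are thus the fixed points of
  \<open>poisson_deficit k\<close>.\<close>

lemma f_root_eq: "f_root k x = exp x * (poisson_deficit k x - x)"
  by (simp add: f_root_def poisson_deficit_def right_diff_distrib exp_minus mult.assoc[symmetric])

lemma has_derivative_deficit_sum:
  "((\<lambda>x. \<Sum>i<Suc k. real (Suc k - i) * (x ^ i / fact i)) has_real_derivative
    (\<Sum>i<k. real (k - i) * (x ^ i / fact i))) (at x)"
proof -
  have eq: "(\<Sum>i<Suc k. real (Suc k - i) * (x ^ i / fact i)) =
        real (Suc k) + (\<Sum>i<k. real (k - i) * (x ^ Suc i / fact (Suc i)))" for x :: real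
    by (subst sum.lessThan_Suc_shift) simp
  have *: "((\<lambda>x. x ^ Suc i / fact (Suc i)) has_real_derivative x ^ i / fact i) (at x)" for i
    by (rule derivative_eq_intros refl | simp)+
  have "((\<lambda>x. real (Suc k) + (\<Sum>i<k. real (k - i) * (x ^ Suc i / fact (Suc i)))) has_real_derivative
      (0 + (\<Sum>i<k. real (k - i) * (x ^ i / fact i)))) (at x)"
    by (intro DERIV_add DERIV_const DERIV_sum DERIV_cmult *)
  then show ?thesis unfolding eq by simp
qed

text \<open>For \<open>x \<ge> 0\<close> the derivative is minus the probability that a Poisson
  variable with mean \<open>x\<close> is at most \<open>k\<close>, hence not positive.\<close>

lemma DERIV_poisson_deficit:
  "(poisson_deficit (Suc k) has_real_derivative (poisson_deficit k x - poisson_deficit (Suc k) x)) (at x)"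
proof -
  have "((\<lambda>x. exp (- x) * (\<Sum>i<Suc k. real (Suc k - i) * (x ^ i / fact i))) has_real_derivative
      (- exp (- x)) * (\<Sum>i<Suc k. real (Suc k - i) * (x ^ i / fact i)) +
      (\<Sum>i<k. real (k - i) * (x ^ i / fact i)) * exp (- x)) (at x)"
    by (intro DERIV_mult has_derivative_deficit_sum) (auto intro!: derivative_eq_intros)
  then show ?thesis by (simp add: poisson_deficit_def[abs_def] mult.commute)
qed

lemma poisson_deficit_mono_index:
  assumes "x \<ge> 0"
  shows "poisson_deficit k x \<le> poisson_deficit (Suc k) x"
proof -
  have "(\<Sum>i<k. real (k - i) * (x ^ i / fact i)) \<le> (\<Sum>i<k. real (Suc k - i) * (x ^ i / fact i))"
    using assms by (intro sum_mono mult_right_mono) auto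
  also have "\<dots> \<le> (\<Sum>i<Suc k. real (Suc k - i) * (x ^ i / fact i))"
    using assms by simp
  finally show ?thesis by (simp add: poisson_deficit_def)
qed

lemma poisson_deficit_antimono:
  assumes "0 \<le> x" "x \<le> y"
  shows "poisson_deficit k y \<le> poisson_deficit k x"
proof (cases k)
  case (Suc j)
  show ?thesis unfolding Suc
  proof (rule DERIV_nonpos_imp_nonincreasing[OF assms(2)])
    fix z assume "x \<le> z" "z \<le> y"
    then show "\<exists>d. (poisson_deficit (Suc j) has_real_derivative d) (at z) \<and> d \<le> 0"
      using DERIV_poisson_deficit[of j z] poisson_deficit_mono_index[of z j] assms by force
  qed
qed (simp add: poisson_deficit_def)

lemma poisson_deficit_0 [simp]: "poisson_deficit k 0 = real k"
  by (cases k) (simp_all add: poisson_deficit_def sum.lessThan_Suc_shift)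

text \<open>An antitone function minus the identity is strictly decreasing, which gives uniqueness.
  The difference is \<open>k > 0\<close> at \<open>0\<close> and not positive at
  \<open>k + 1\<close>, so the intermediate value theorem gives a root, and it is not
  \<open>0\<close>.\<close>

lemma ex1_f_root:
  assumes "k \<ge> 1"
  shows "\<exists>!x. x > 0 \<and> f_root k x = 0"
proof -
  let ?g = "\<lambda>x. poisson_deficit k x - x"
  have "continuous_on {0..real k + 1} ?g"
    unfolding poisson_deficit_def by (intro continuous_intros) auto
  moreover have "?g (real k + 1) \<le> 0" using poisson_deficit_antimono[of 0 "real k + 1" k] by simp
  ultimately obtain x where x: "0 \<le> x" "?g x = 0"
    using IVT2'[of ?g "real k + 1" 0 0] by auto
  with assms have "x > 0" by (cases "x = 0") auto
  moreover have "y = z" if "?g y = 0" "?g z = 0" "y > 0" "z > 0" for y z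
    using that poisson_deficit_antimono[of y z k] poisson_deficit_antimono[of z y k]
    by (cases y z rule: linorder_le_cases) auto
  ultimately show ?thesis using x by (auto simp: f_root_eq)
qed

lemma alpha_props:
  assumes "k \<ge> 1"
  shows "alpha k > 0" "poisson_deficit k (alpha k) = alpha k"
  using theI'[OF ex1_f_root[OF assms]] by (auto simp: alpha_def f_root_eq)

lemma poisson_deficit_above_alpha:
  assumes "k \<ge> 1" "c > alpha k"
  shows "poisson_deficit k c < c"
  using poisson_deficit_antimono[of "alpha k" c k] alpha_props[OF assms(1)] assms(2) by simp

lemma poisson_deficit_below_alpha:
  assumes "k \<ge> 1" "0 \<le> c" "c < alpha k"
  shows "poisson_deficit k c > c"
  using poisson_deficit_antimono[of c "alpha k" k] alpha_props[OF assms(1)] assms by simp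

section \<open>Binomial point masses, the mean binomial shortfall and their Poisson limits\<close>

definition binomial_weight :: "real \<Rightarrow> nat \<Rightarrow> nat \<Rightarrow> real" where
  "binomial_weight q m i = real (m choose i) * q ^ i * (1 - q) ^ (m - i)"

lemma binomial_weight_0_Suc: "binomial_weight q (Suc m) 0 = (1 - q) * binomial_weight q m 0"
  by (simp add: binomial_weight_def)

lemma binomial_weight_Suc_Suc:
  "binomial_weight q (Suc m) (Suc i) = (1 - q) * binomial_weight q m (Suc i) + q * binomial_weight q m i"
proof (cases "Suc i \<le> m")
  case True
  then have pw: "(1 - q) ^ (m - i) = (1 - q) * (1 - q) ^ (m - Suc i)"
    by (simp flip: power_Suc add: Suc_diff_Suc)
  show ?thesis
    unfolding binomial_weight_def binomial_Suc_Suc diff_Suc_Suc of_nat_add power_Suc pw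
    by (simp add: algebra_simps)
next
  case False
  then show ?thesis by (simp add: binomial_weight_def binomial_eq_0)
qed

definition binomial_deficit :: "real \<Rightarrow> nat \<Rightarrow> nat \<Rightarrow> real" where
  "binomial_deficit q k m = (\<Sum>i<k. real (k - i) * binomial_weight q m i)"

lemma binomial_deficit_0: "binomial_deficit q k 0 = real k"
proof -
  have "binomial_weight q 0 i = (if i = 0 then 1 else 0)" for i
    by (simp add: binomial_weight_def binomial_eq_0)
  then show ?thesis
    by (cases k) (simp_all add: binomial_deficit_def sum.lessThan_Suc_shift del: sum.lessThan_Suc of_nat_diff)
qed

text \<open>Conditioning on one trial: a success lowers the remaining target from
  \<open>Suc k\<close> to \<open>k\<close>.\<close>

lemma binomial_deficit_Suc:
  "binomial_deficit q (Suc k) (Suc m) = (1 - q) * binomial_deficit q (Suc k) m + q * binomial_deficit q k m"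
  unfolding binomial_deficit_def
  by (simp only: sum.lessThan_Suc_shift binomial_weight_Suc_Suc binomial_weight_0_Suc)
     (simp only: diff_Suc_Suc distrib_left sum.distrib sum_distrib_left ac_simps)

text \<open>Poisson limit by induction on \<open>i\<close>: the base case is
  \<open>(1 - 1/n) ^ m n\<close>, written through the logarithm, and consecutive weights have ratio
  \<open>(m n - i) q / ((i + 1) (1 - q))\<close> with \<open>q = 1/n\<close>, which tends to
  \<open>c / (i + 1)\<close>.\<close>

lemma binomial_weight_tendsto:
  assumes m: "(\<lambda>n. real (m n) / real n) \<longlonglongrightarrow> c" and "c > 0"
  shows "(\<lambda>n. binomial_weight (1 / real n) (m n) i) \<longlonglongrightarrow> exp (- c) * (c ^ i / fact i)"
proof (induction i)
  case 0
  have "(\<lambda>n. real n * ln (1 - 1 / real n)) \<longlonglongrightarrow> -1" by real_asymp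
  from tendsto_mult[OF m this]
  have "(\<lambda>n. exp (real (m n) / real n * (real n * ln (1 - 1 / real n)))) \<longlonglongrightarrow> exp (- c)"
    by (intro tendsto_exp) simp
  moreover have "eventually (\<lambda>n. exp (real (m n) / real n * (real n * ln (1 - 1 / real n))) =
       binomial_weight (1 / real n) (m n) 0) sequentially"
    using eventually_gt_at_top[of 1]
  proof eventually_elim
    case (elim n)
    then have "exp (real (m n) * ln (1 - 1 / real n)) = (1 - 1 / real n) ^ m n"
      by (subst exp_of_nat_mult) simp
    with elim show ?case by (simp add: binomial_weight_def)
  qed
  ultimately show ?case by (simp add: tendsto_cong)
next
  case (Suc i)
  have inv: "(\<lambda>n. 1 / real n) \<longlonglongrightarrow> 0" by real_asymp
  have "(\<lambda>n. (real (m n) / real n - real i * (1 / real n)) / (real (Suc i) * (1 - 1 / real n)))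
      \<longlonglongrightarrow> (c - real i * 0) / (real (Suc i) * (1 - 0))"
    by (intro tendsto_intros m inv) auto
  from tendsto_mult[OF Suc.IH this]
  have "(\<lambda>n. binomial_weight (1 / real n) (m n) i *
      ((real (m n) / real n - real i * (1 / real n)) / (real (Suc i) * (1 - 1 / real n))))
      \<longlonglongrightarrow> exp (- c) * (c ^ Suc i / fact (Suc i))" (is "?f \<longlonglongrightarrow> _")
    by (simp add: field_simps)
  moreover have "eventually (\<lambda>n. ?f n = binomial_weight (1 / real n) (m n) (Suc i)) sequentially"
    using eventually_gt_at_top[of 1]
  proof eventually_elim
    case (elim n)
    define q where "q = 1 / real n"
    have q: "q \<noteq> 1" "q \<noteq> 0" using elim by (auto simp: q_def)
    show ?case
    proof (cases "i < m n")
      case True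
      have "real (Suc i) * real (m n choose Suc i) = (real (m n) - real i) * real (m n choose i)"
      proof -
        have "Suc i * (m n choose Suc i) = (m n - i) * (m n choose i)"
          by (metis binomial_absorb_comp binomial_absorption mult.commute)
        then have "real (Suc i * (m n choose Suc i)) = real ((m n - i) * (m n choose i))" by simp
        then show ?thesis by (simp only: of_nat_mult of_nat_diff[OF less_imp_le[OF True]])
      qed
      then have ch: "real (m n choose Suc i) = (real (m n) - real i) * real (m n choose i) / real (Suc i)"
        by (simp add: field_simps)
      have pw: "(1 - q) ^ (m n - i) = (1 - q) * (1 - q) ^ (m n - Suc i)"
        using True by (simp flip: power_Suc add: Suc_diff_Suc)
      have nq: "real (m n) / real n - real i * (1 / real n) = q * (real (m n) - real i)"
        by (simp add: q_def algebra_simps)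
      show ?thesis
        unfolding binomial_weight_def nq unfolding q_def[symmetric] ch pw
        using q by simp
    next
      \<comment> \<open>Both sides vanish here; for \<open>i = m n\<close> it is the ratio factor
        that is zero.\<close>
      case False
      then show ?thesis by (cases "m n = i") (auto simp: binomial_weight_def binomial_eq_0)
    qed
  qed
  ultimately show ?case by (simp only: tendsto_cong)
qed

lemma binomial_deficit_tendsto:
  assumes "(\<lambda>n. real (m n) / real n) \<longlonglongrightarrow> c" "c > 0"
  shows "(\<lambda>n. binomial_deficit (1 / real n) k (m n)) \<longlonglongrightarrow> poisson_deficit k c"
  unfolding binomial_deficit_def poisson_deficit_def sum_distrib_left
  unfolding mult.left_commute[of "exp (- c)"]
  by (intro tendsto_sum tendsto_mult_left binomial_weight_tendsto assms)

section \<open>Occurrence counts after uniform rounds\<close>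

text \<open>The transition operator of one uniform round acting on functions of the count
  vector.\<close>

definition step_mean :: "nat \<Rightarrow> ((nat \<Rightarrow> nat) \<Rightarrow> real) \<Rightarrow> (nat \<Rightarrow> nat) \<Rightarrow> real" where
  "step_mean n F d = (\<Sum>x\<in>{1..n}. F (d(x := Suc (d x)))) / real n"

text \<open>The expectation of \<open>F\<close> at the counts after \<open>m\<close> rounds,
  obtained by iterating the transition operator. The recursion makes moment bounds plain inductions
  without measure theory; \<open>count_mean_eq_sum\<close> links it to the uniform law.\<close>

primrec count_mean :: "nat \<Rightarrow> nat \<Rightarrow> ((nat \<Rightarrow> nat) \<Rightarrow> real) \<Rightarrow> real" where
  "count_mean n 0 F = F (\<lambda>_. 0)"
| "count_mean n (Suc m) F = count_mean n m (step_mean n F)"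

lemma count_mean_add: "count_mean n m (\<lambda>d. F d + G d) = count_mean n m F + count_mean n m G"
proof (induction m arbitrary: F G)
  case (Suc m)
  have "step_mean n (\<lambda>d. F d + G d) = (\<lambda>d. step_mean n F d + step_mean n G d)"
    by (simp add: step_mean_def fun_eq_iff sum.distrib add_divide_distrib)
  then show ?case using Suc.IH by simp
qed simp

lemma count_mean_cmult: "count_mean n m (\<lambda>d. c * F d) = c * count_mean n m F"
proof (induction m arbitrary: F)
  case (Suc m)
  have "step_mean n (\<lambda>d. c * F d) = (\<lambda>d. c * step_mean n F d)"
    by (simp add: step_mean_def fun_eq_iff sum_distrib_left)
  then show ?case using Suc.IH by simp
qed simp

lemma count_mean_const:
  assumes "n > 0"
  shows "count_mean n m (\<lambda>_. c) = c"
proof (induction m)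
  case (Suc m)
  have "step_mean n (\<lambda>_. c) = (\<lambda>_. c)" using assms by (simp add: step_mean_def fun_eq_iff)
  then show ?case using Suc.IH by simp
qed simp

lemma count_mean_sum: "count_mean n m (\<lambda>d. \<Sum>x\<in>A. F x d) = (\<Sum>x\<in>A. count_mean n m (F x))"
proof (induction A rule: infinite_finite_induct)
  case (insert x A)
  then show ?case by (simp add: count_mean_add)
qed (use count_mean_cmult[of n m 0] in auto)

lemma count_mean_mono:
  assumes "\<And>d. F d \<le> G d"
  shows "count_mean n m F \<le> count_mean n m G"
  using assms
proof (induction m arbitrary: F G)
  case (Suc m)
  have "step_mean n F d \<le> step_mean n G d" for d
    unfolding step_mean_def by (intro divide_right_mono sum_mono Suc.prems) auto
  then show ?case using Suc.IH by simp
qed simp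

text \<open>
  Efron--Stein: replacing the vertex of one round changes \<open>F\<close> by at most \<open>1\<close>, a property that
  \<^const>\<open>step_mean\<close> preserves, so that every round contributes at most \<open>1\<close> to the variance.
\<close>

lemma count_variance_le:
  assumes "n > 0" "\<And>d x y. \<bar>F (d(x := Suc (d x))) - F (d(y := Suc (d y)))\<bar> \<le> 1"
  shows "count_mean n m (\<lambda>d. (F d)\<^sup>2) - (count_mean n m F)\<^sup>2 \<le> real m"
  using assms(2)
proof (induction m arbitrary: F)
  case (Suc m)
  let ?T = "step_mean n F"
  have n: "real n > 0" using assms(1) by simp
  have lip: "\<bar>?T (d(x := Suc (d x))) - ?T (d(y := Suc (d y)))\<bar> \<le> 1" for d x y
  proof -
    \<comment> \<open>Increments commute, so a difference of averages is an average of differences,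
      each at most \<open>1\<close> in absolute value.\<close>
    have comm: "(d(x := Suc (d x)))(z := Suc ((d(x := Suc (d x))) z)) =
                (d(z := Suc (d z)))(x := Suc ((d(z := Suc (d z))) x))" for x z
      by auto
    have "?T (d(x := Suc (d x))) - ?T (d(y := Suc (d y))) =
        (\<Sum>z\<in>{1..n}. F ((d(z := Suc (d z)))(x := Suc ((d(z := Suc (d z))) x))) -
                     F ((d(z := Suc (d z)))(y := Suc ((d(z := Suc (d z))) y)))) / real n"
      unfolding step_mean_def comm[of x] comm[of y] by (simp add: sum_subtractf diff_divide_distrib)
    moreover have "\<bar>\<Sum>z\<in>{1..n}. F ((d(z := Suc (d z)))(x := Suc ((d(z := Suc (d z))) x))) -
                     F ((d(z := Suc (d z)))(y := Suc ((d(z := Suc (d z))) y)))\<bar> \<le> (\<Sum>z\<in>{1..n}. 1)"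
      by (intro order_trans[OF sum_abs] sum_mono Suc.prems)
    ultimately show ?thesis using n by (simp add: divide_le_eq)
  qed
  \<comment> \<open>The variance within one round: every value lies within \<open>1\<close> of the
    average over the chosen vertex.\<close>
  have var: "step_mean n (\<lambda>d. (F d)\<^sup>2) d \<le> (?T d)\<^sup>2 + 1" for d
  proof -
    define f where "f x = F (d(x := Suc (d x)))" for x
    define \<mu> where "\<mu> = ?T d"
    have \<mu>: "(\<Sum>x\<in>{1..n}. f x) = real n * \<mu>"
      using n by (simp add: \<mu>_def step_mean_def f_def)
    have "\<bar>f x - \<mu>\<bar> \<le> 1" for x
    proof -
      have "f x - \<mu> = (\<Sum>y\<in>{1..n}. f x - f y) / real n"
        using n unfolding sum_subtractf \<mu> by (simp add: field_simps)
      moreover have "\<bar>\<Sum>y\<in>{1..n}. f x - f y\<bar> \<le> (\<Sum>y\<in>{1..n}. 1)"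
        unfolding f_def by (intro order_trans[OF sum_abs] sum_mono Suc.prems)
      ultimately show ?thesis using n by (simp add: divide_le_eq)
    qed
    then have "(\<Sum>x\<in>{1..n}. (f x - \<mu>)\<^sup>2) \<le> (\<Sum>x\<in>{1..n}. 1)"
      by (intro sum_mono) (simp add: abs_square_le_1)
    moreover have "(\<Sum>x\<in>{1..n}. (f x - \<mu>)\<^sup>2) = (\<Sum>x\<in>{1..n}. (f x)\<^sup>2) - real n * \<mu>\<^sup>2"
    proof -
      have "(\<Sum>x\<in>{1..n}. (f x - \<mu>)\<^sup>2) = (\<Sum>x\<in>{1..n}. (f x)\<^sup>2 + \<mu>\<^sup>2 - 2 * \<mu> * f x)"
        by (intro sum.cong) (auto simp: power2_eq_square algebra_simps)
      also have "\<dots> = (\<Sum>x\<in>{1..n}. (f x)\<^sup>2) + real n * \<mu>\<^sup>2 - 2 * \<mu> * (\<Sum>x\<in>{1..n}. f x)"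
        by (simp add: sum_subtractf sum.distrib sum_distrib_left)
      finally show ?thesis unfolding \<mu> by (simp add: power2_eq_square)
    qed
    ultimately have "(\<Sum>x\<in>{1..n}. (f x)\<^sup>2) \<le> real n * (\<mu>\<^sup>2 + 1)" by (simp add: algebra_simps)
    then show ?thesis
      using n unfolding step_mean_def[of n "\<lambda>d. (F d)\<^sup>2"] f_def \<mu>_def by (simp add: divide_le_eq mult.commute)
  qed
  \<comment> \<open>Total variance: this round adds at most \<open>1\<close> to the variance of the
    conditional mean \<open>?T\<close>, which the induction hypothesis bounds by
    \<open>m\<close>.\<close>
  have "count_mean n m (step_mean n (\<lambda>d. (F d)\<^sup>2)) \<le> count_mean n m (\<lambda>d. (?T d)\<^sup>2 + 1)"
    by (intro count_mean_mono var)
  then show ?case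
    using Suc.IH[of ?T, OF lip] by (simp add: count_mean_add count_mean_const[OF assms(1)])
qed simp

lemma count_chebyshev:
  assumes "n > 0" "\<And>d x y. \<bar>F (d(x := Suc (d x))) - F (d(y := Suc (d y)))\<bar> \<le> 1" "a > 0"
  shows "count_mean n m (\<lambda>d. of_bool (\<bar>F d - count_mean n m F\<bar> \<ge> a)) \<le> real m / a\<^sup>2"
proof -
  define \<mu> where "\<mu> = count_mean n m F"
  \<comment> \<open>Markov's inequality for the squared deviation, expanded so that linearity of
    \<open>count_mean\<close> applies.\<close>
  have "count_mean n m (\<lambda>d. of_bool (\<bar>F d - \<mu>\<bar> \<ge> a)) \<le> count_mean n m (\<lambda>d. (1 / a\<^sup>2) * ((F d)\<^sup>2 + ((-2 * \<mu>) * F d + \<mu>\<^sup>2)))"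
  proof (rule count_mean_mono)
    fix d
    have "of_bool (\<bar>F d - \<mu>\<bar> \<ge> a) \<le> (F d - \<mu>)\<^sup>2 / a\<^sup>2"
      using assms(3) abs_le_square_iff[of a "F d - \<mu>"] by (auto simp: le_divide_eq)
    moreover have "(F d)\<^sup>2 + ((-2 * \<mu>) * F d + \<mu>\<^sup>2) = (F d - \<mu>)\<^sup>2"
      by (simp add: power2_diff)
    ultimately show "of_bool (\<bar>F d - \<mu>\<bar> \<ge> a) \<le> (1 / a\<^sup>2) * ((F d)\<^sup>2 + ((-2 * \<mu>) * F d + \<mu>\<^sup>2))"
      by simp
  qed
  also have "\<dots> = (1 / a\<^sup>2) * (count_mean n m (\<lambda>d. (F d)\<^sup>2) - \<mu>\<^sup>2)"
    by (simp only: count_mean_cmult count_mean_add count_mean_const[OF assms(1)] \<mu>_def[symmetric])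
       (simp add: power2_eq_square)
  also have "\<dots> \<le> (1 / a\<^sup>2) * real m"
    using count_variance_le[of n F m, OF assms(1,2)] assms(3) unfolding \<mu>_def[symmetric]
    by (intro mult_left_mono) auto
  finally show ?thesis by (simp add: \<mu>_def)
qed

section \<open>Counts of a single vertex, the mean deficiency and the largest count\<close>

lemma step_mean_single:
  assumes "n > 0" "x \<in> {1..n}"
  shows "step_mean n (\<lambda>d. g (d x)) = (\<lambda>d. (1 - 1 / real n) * g (d x) + (1 / real n) * g (Suc (d x)))"
proof
  fix d
  have "(\<Sum>y\<in>{1..n}. g ((d(y := Suc (d y))) x)) = g (Suc (d x)) + (\<Sum>y\<in>{1..n} - {x}. g ((d(y := Suc (d y))) x))"
    using assms by (subst sum.remove[of _ x]) auto
  also have "(\<Sum>y\<in>{1..n} - {x}. g ((d(y := Suc (d y))) x)) = (\<Sum>y\<in>{1..n} - {x}. g (d x))"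
    by (intro sum.cong) auto
  also have "\<dots> = (real n - 1) * g (d x)" using assms by (simp add: of_nat_diff)
  finally show "step_mean n (\<lambda>d. g (d x)) d = (1 - 1 / real n) * g (d x) + (1 / real n) * g (Suc (d x))"
    using assms(1) by (simp add: step_mean_def field_simps)
qed

text \<open>The count of \<open>x\<close> is binomial: both sides obey the same recursion in
  \<open>m\<close>. The target \<open>k\<close> is generalised because an offer of \<open>x\<close>
  lowers it by one.\<close>

lemma count_mean_shortfall:
  assumes "n > 0" "x \<in> {1..n}"
  shows "count_mean n m (\<lambda>d. real (k - d x)) = binomial_deficit (1 / real n) k m"
proof (induction m arbitrary: k)
  case 0
  then show ?case by (simp add: binomial_deficit_0)
next
  case (Suc m)
  show ?case
  proof (cases k)
    case 0
    then show ?thesis using count_mean_const[OF assms(1), of "Suc m" 0]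
      by (simp add: binomial_deficit_def del: count_mean.simps)
  next
    case (Suc j)
    then show ?thesis
      by (simp only: count_mean.simps step_mean_single[OF assms, where g = "\<lambda>d. real (Suc j - d)"]
          diff_Suc_Suc count_mean_add count_mean_cmult Suc.IH binomial_deficit_Suc)
  qed
qed

lemma count_mean_deficiency:
  assumes "n > 0"
  shows "count_mean n m (\<lambda>d. real (deficiency k n d)) = real n * binomial_deficit (1 / real n) k m"
  unfolding deficiency_def of_nat_sum count_mean_sum
  using count_mean_shortfall[OF assms] by simp

text \<open>One increment lowers the deficiency by \<open>0\<close> or \<open>1\<close>, so both
  values lie in the same interval of length \<open>1\<close>.\<close>

lemma deficiency_bounded_difference:
  "\<bar>real (deficiency k n (d(x := Suc (d x)))) - real (deficiency k n (d(y := Suc (d y))))\<bar> \<le> 1"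
proof -
  have *: "deficiency k n (d(x := Suc (d x))) \<le> deficiency k n d"
          "deficiency k n d \<le> deficiency k n (d(x := Suc (d x))) + 1" for x
  proof -
    show "deficiency k n (d(x := Suc (d x))) \<le> deficiency k n d"
      unfolding deficiency_def by (intro sum_mono) auto
    have "deficiency k n d \<le> (\<Sum>z\<in>{1..n}. (k - (d(x := Suc (d x))) z) + of_bool (z = x))"
      unfolding deficiency_def by (intro sum_mono) auto
    also have "\<dots> \<le> deficiency k n (d(x := Suc (d x))) + 1"
      by (auto simp: deficiency_def sum.distrib of_bool_def)
    finally show "deficiency k n d \<le> deficiency k n (d(x := Suc (d x))) + 1" .
  qed
  from *[of x] *[of y] show ?thesis by linarith
qed

lemma count_mean_second_moment:
  assumes "n > 0" "x \<in> {1..n}"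
  shows "count_mean n m (\<lambda>d. (real (d x))\<^sup>2) \<le> real m / real n + (real m / real n)\<^sup>2"
proof -
  let ?q = "1 / real n"
  have mean: "count_mean n m (\<lambda>d. real (d x)) = real m * ?q" for m
  proof (induction m)
    case (Suc m)
    have "step_mean n (\<lambda>d. real (d x)) = (\<lambda>d. real (d x) + ?q)"
      using assms(1) by (subst step_mean_single[OF assms]) (auto simp: fun_eq_iff field_simps)
    then show ?case by (simp add: count_mean_add count_mean_const[OF assms(1)] Suc.IH add_divide_distrib)
  qed simp
  show ?thesis
  proof (induction m)
    case (Suc m)
    have "step_mean n (\<lambda>d. (real (d x))\<^sup>2) = (\<lambda>d. (real (d x))\<^sup>2 + ((2 * ?q) * real (d x) + ?q))"
      using assms(1) by (subst step_mean_single[OF assms]) (auto simp: fun_eq_iff field_simps power2_eq_square)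
    then have "count_mean n (Suc m) (\<lambda>d. (real (d x))\<^sup>2) =
        count_mean n m (\<lambda>d. (real (d x))\<^sup>2) + (2 * ?q * (real m * ?q) + ?q)"
      by (simp only: count_mean.simps count_mean_add count_mean_cmult count_mean_const[OF assms(1)] mean)
    also have "\<dots> \<le> real m / real n + (real m / real n)\<^sup>2 + (2 * ?q * (real m * ?q) + ?q)"
      using Suc.IH by simp
    also have "\<dots> \<le> real (Suc m) / real n + (real (Suc m) / real n)\<^sup>2"
      using assms(1) by (simp add: field_simps power2_eq_square)
    finally show ?case .
  qed simp
qed

text \<open>Markov's inequality for the sum of squared counts. With \<open>a\<close> proportional to
  \<open>n\<close> and \<open>m\<close> linear in \<open>n\<close> the bound is of order
  \<open>1/n\<close>.\<close>

lemma count_large_occurrence: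
  assumes "n > 0" "a > 0"
  shows "count_mean n m (\<lambda>d. of_bool (\<exists>x\<in>{1..n}. real (d x) > a)) \<le>
    real n * (real m / real n + (real m / real n)\<^sup>2) / a\<^sup>2"
proof -
  have "count_mean n m (\<lambda>d. of_bool (\<exists>x\<in>{1..n}. real (d x) > a)) \<le>
        count_mean n m (\<lambda>d. (1 / a\<^sup>2) * (\<Sum>x\<in>{1..n}. (real (d x))\<^sup>2))"
  proof (rule count_mean_mono)
    fix d :: "nat \<Rightarrow> nat"
    show "of_bool (\<exists>x\<in>{1..n}. real (d x) > a) \<le> (1 / a\<^sup>2) * (\<Sum>x\<in>{1..n}. (real (d x))\<^sup>2)"
    proof (cases "\<exists>x\<in>{1..n}. real (d x) > a")
      case True
      then obtain x where x: "x \<in> {1..n}" "real (d x) > a" by blast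
      have "a\<^sup>2 \<le> (real (d x))\<^sup>2" using x assms by (intro power_mono) auto
      also have "\<dots> \<le> (\<Sum>x\<in>{1..n}. (real (d x))\<^sup>2)" using x by (intro member_le_sum) auto
      finally show ?thesis using True assms(2) by (simp add: le_divide_eq)
    qed (simp add: sum_nonneg)
  qed
  also have "\<dots> = (1 / a\<^sup>2) * (\<Sum>x\<in>{1..n}. count_mean n m (\<lambda>d. (real (d x))\<^sup>2))"
    by (simp only: count_mean_cmult count_mean_sum)
  also have "\<dots> \<le> (1 / a\<^sup>2) * (\<Sum>x\<in>{1..n}. real m / real n + (real m / real n)\<^sup>2)"
    by (intro mult_left_mono sum_mono count_mean_second_moment assms) auto
  finally show ?thesis by simp
qed

section \<open>Success probabilities\<close>

text \<open>Splitting off the last round turns the iterated operator into the average over all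
  \<open>n ^ m\<close> prefixes.\<close>

lemma count_mean_eq_sum:
  "count_mean n m F = (\<Sum>w\<in>{1..m} \<rightarrow>\<^sub>E {1..n}. F (occurrences {1..m} w)) / real n ^ m"
proof (induction m arbitrary: F)
  case 0
  show ?case by (simp add: occurrences_def[abs_def])
next
  case (Suc m)
  have ins: "{1..Suc m} = insert (Suc m) {1..m}" by auto
  have occ: "occurrences {1..Suc m} (w(Suc m := x)) =
      (occurrences {1..m} w)(x := Suc (occurrences {1..m} w x))" for w x
  proof
    fix y
    have "{t \<in> {1..m}. (w(Suc m := x)) t = y} = {t \<in> {1..m}. w t = y}" by auto
    moreover have "{1..Suc m} - {Suc m} = {1..m}" by auto
    ultimately show "occurrences {1..Suc m} (w(Suc m := x)) y =
      ((occurrences {1..m} w)(x := Suc (occurrences {1..m} w x))) y"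
      using occurrences_remove[of "{1..Suc m}" "Suc m" "w(Suc m := x)" y]
      by (auto simp: occurrences_def)
  qed
  have "(\<Sum>w\<in>{1..Suc m} \<rightarrow>\<^sub>E {1..n}. F (occurrences {1..Suc m} w)) =
      (\<Sum>(x, w)\<in>{1..n} \<times> ({1..m} \<rightarrow>\<^sub>E {1..n}). F (occurrences {1..Suc m} (w(Suc m := x))))"
    unfolding ins PiE_insert_eq
    by (subst sum.reindex[OF inj_combinator]) (auto simp: case_prod_unfold)
  also have "\<dots> = (\<Sum>w\<in>{1..m} \<rightarrow>\<^sub>E {1..n}. \<Sum>x\<in>{1..n}.
        F ((occurrences {1..m} w)(x := Suc (occurrences {1..m} w x))))"
    unfolding occ sum.cartesian_product[symmetric] by (rule sum.swap)
  finally show ?case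
    by (simp only: count_mean.simps Suc.IH)
       (simp add: step_mean_def sum_divide_distrib[symmetric])
qed

section \<open>Events determined by finitely many rounds\<close>

lemma prob_space_vertex_law: "n > 0 \<Longrightarrow> prob_space (vertex_law n)"
  unfolding vertex_law_def by (intro prob_space_PiM prob_space_uniform_count_measure) auto

text \<open>The factors \<open>M t\<close> are general so that this serves both
  \<open>vertex_law\<close> and \<open>choice_space\<close>. The target is discrete, so every
  predicate of a prefix becomes measurable.\<close>

lemma measurable_restrict_prefix:
  fixes M :: "nat \<Rightarrow> nat measure"
  assumes "\<And>t. sets (M t) = sets (count_space {1..n})"
  shows "(\<lambda>v. restrict v {1..m}) \<in> (\<Pi>\<^sub>M t\<in>{1..}. M t) \<rightarrow>\<^sub>M count_space ({1..m} \<rightarrow>\<^sub>E {1..n})"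
proof -
  have "(\<lambda>v. restrict v {1..m}) \<in> (\<Pi>\<^sub>M t\<in>{1..}. M t) \<rightarrow>\<^sub>M (\<Pi>\<^sub>M t\<in>{1..m}. count_space {1..n})"
    by (intro measurable_restrict_subset') (auto simp: assms)
  moreover have "(\<Pi>\<^sub>M t\<in>{1..m}. count_space {1..n}) = count_space ({1..m} \<rightarrow>\<^sub>E {1..n})"
    by (rule count_space_PiM_finite) (simp_all add: countable_finite)
  ultimately show ?thesis by simp
qed

lemma measurable_restrict_vertex_law:
  "(\<lambda>v. restrict v {1..m}) \<in> vertex_law n \<rightarrow>\<^sub>M count_space ({1..m} \<rightarrow>\<^sub>E {1..n})"
  unfolding vertex_law_def
  by (intro measurable_restrict_prefix) (rule sets_uniform_count_measure_count_space)

lemma measurable_restrict_choice_space: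
  "(\<lambda>u. restrict u {1..m}) \<in> choice_space n \<rightarrow>\<^sub>M count_space ({1..m} \<rightarrow>\<^sub>E {1..n})"
  unfolding choice_space_def by (intro measurable_restrict_prefix) auto

lemma prefix_event_measurable:
  "{v \<in> space (vertex_law n). Q (restrict v {1..m})} \<in> sets (vertex_law n)"
proof -
  have "(\<lambda>v. restrict v {1..m}) -` {w \<in> {1..m} \<rightarrow>\<^sub>E {1..n}. Q w} \<inter> space (vertex_law n) \<in> sets (vertex_law n)"
    by (rule measurable_sets[OF measurable_restrict_vertex_law]) auto
  also have "(\<lambda>v. restrict v {1..m}) -` {w \<in> {1..m} \<rightarrow>\<^sub>E {1..n}. Q w} \<inter> space (vertex_law n) =
      {v \<in> space (vertex_law n). Q (restrict v {1..m})}"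
    using measurable_space[OF measurable_restrict_vertex_law[of m n]] by auto
  finally show ?thesis .
qed

text \<open>The projection to the first \<open>m\<close> rounds has the finite product law, which
  gives each single prefix the mass \<open>1 / n ^ m\<close>.\<close>

lemma prefix_event_prob:
  assumes "n > 0"
  shows "measure (vertex_law n) {v \<in> space (vertex_law n). Q (restrict v {1..m})} =
    (\<Sum>w\<in>{1..m} \<rightarrow>\<^sub>E {1..n}. of_bool (Q w)) / real n ^ m"
proof -
  let ?J = "{1..m}" and ?M = "\<lambda>_::nat. uniform_count_measure {1..n}"
  let ?W = "?J \<rightarrow>\<^sub>E {1..n}"
  interpret product_prob_space ?M "{1..}"
    using assms by (intro product_prob_spaceI prob_space_uniform_count_measure) auto
  interpret J: finite_product_prob_space ?M ?J by unfold_locales auto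
  have sets_J: "A \<in> sets (PiM ?J ?M)" if "A \<subseteq> ?W" for A
  proof -
    have "sets (PiM ?J ?M) = sets (PiM ?J (\<lambda>_. count_space {1..n}))"
      by (intro sets_PiM_cong) (auto simp: sets_uniform_count_measure)
    also have "PiM ?J (\<lambda>_. count_space {1..n}) = count_space ?W"
      by (rule count_space_PiM_finite) (simp_all add: countable_finite)
    finally show ?thesis using that by simp
  qed
  have space_J: "space (PiM ?J ?M) = ?W" by (simp add: space_PiM space_uniform_count_measure)
  have fin: "finite {w \<in> ?W. Q w}" by (simp add: finite_PiE)
  have "measure (vertex_law n) {v \<in> space (vertex_law n). Q (restrict v ?J)} =
        measure (distr (vertex_law n) (PiM ?J ?M) (\<lambda>v. restrict v ?J)) {w \<in> ?W. Q w}"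
  proof (subst measure_distr)
    show "(\<lambda>v. restrict v ?J) \<in> vertex_law n \<rightarrow>\<^sub>M PiM ?J ?M"
      unfolding vertex_law_def by (intro measurable_restrict_subset) auto
    show "{w \<in> ?W. Q w} \<in> sets (PiM ?J ?M)" by (rule sets_J) auto
    show "measure (vertex_law n) {v \<in> space (vertex_law n). Q (restrict v ?J)} =
      measure (vertex_law n) ((\<lambda>v. restrict v ?J) -` {w \<in> ?W. Q w} \<inter> space (vertex_law n))"
      using measurable_space[OF measurable_restrict_vertex_law[of m n]]
      by (intro arg_cong[of _ _ "measure (vertex_law n)"]) auto
  qed
  also have "distr (vertex_law n) (PiM ?J ?M) (\<lambda>v. restrict v ?J) = PiM ?J ?M"
    unfolding vertex_law_def by (intro distr_PiM_restrict_finite) auto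
  also have "measure (PiM ?J ?M) {w \<in> ?W. Q w} = (\<Sum>w\<in>{w \<in> ?W. Q w}. measure (PiM ?J ?M) {w})"
    by (intro J.finite_measure_eq_sum_singleton fin sets_J) auto
  also have "\<dots> = (\<Sum>w\<in>{w \<in> ?W. Q w}. 1 / real n ^ m)"
  proof (intro sum.cong refl)
    fix w assume "w \<in> {w \<in> ?W. Q w}"
    then have w: "w \<in> ?W" by simp
    then have "{w} = PiE ?J (\<lambda>t. {w t})" by (intro PiE_singleton[symmetric]) (auto simp: PiE_def)
    then have "measure (PiM ?J ?M) {w} = (\<Prod>t\<in>?J. measure (?M t) {w t})"
      using w J.prob_times[of "\<lambda>t. {w t}"] by (auto simp: sets_uniform_count_measure PiE_iff)
    also have "\<dots> = (\<Prod>t\<in>?J. 1 / real n)"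
      using w by (intro prod.cong) (auto simp: measure_uniform_count_measure PiE_iff)
    finally show "measure (PiM ?J ?M) {w} = 1 / real n ^ m" by (simp add: power_one_over)
  qed
  also have "\<dots> = (\<Sum>w\<in>?W. of_bool (Q w)) / real n ^ m"
    by (simp add: sum_divide_distrib of_bool_def sum.If_cases finite_PiE Int_def)
  finally show ?thesis .
qed

lemma occurrences_restrict [simp]: "occurrences R (restrict v R) = occurrences R v"
  unfolding occurrences_def by (intro ext arg_cong[of _ _ card]) auto

lemma occurrence_event_measurable:
  "{v \<in> space (vertex_law n). Q (occurrences {1..m} v)} \<in> sets (vertex_law n)"
  using prefix_event_measurable[of n "\<lambda>w. Q (occurrences {1..m} w)" m] by simp

lemma occurrence_event_prob:
  assumes "n > 0"
  shows "measure (vertex_law n) {v \<in> space (vertex_law n). Q (occurrences {1..m} v)} =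
    count_mean n m (\<lambda>d. of_bool (Q d))"
  using prefix_event_prob[OF assms, of "\<lambda>w. Q (occurrences {1..m} w)" m]
  by (simp add: count_mean_eq_sum)

lemma builder_graph_restrict:
  "builder_graph m (restrict v {1..m}, restrict u {1..m}) = builder_graph m (v, u)"
  unfolding builder_graph_def by (auto intro!: image_mset_cong)

lemma builder_graph_event_measurable:
  "{\<omega> \<in> space (vertex_law n \<Otimes>\<^sub>M choice_space n). builder_graph m \<omega> \<in> \<P>}
     \<in> sets (vertex_law n \<Otimes>\<^sub>M choice_space n)"
proof -
  let ?W = "{1..m} \<rightarrow>\<^sub>E {1..n}"
  let ?r = "\<lambda>\<omega>. (restrict (fst \<omega>) {1..m}, restrict (snd \<omega>) {1..m})"
  have fin: "countable ?W" by (intro countable_finite finite_PiE) auto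
  have "?r \<in> vertex_law n \<Otimes>\<^sub>M choice_space n \<rightarrow>\<^sub>M count_space ?W \<Otimes>\<^sub>M count_space ?W"
    by (intro measurable_Pair measurable_compose[OF measurable_fst measurable_restrict_vertex_law]
        measurable_compose[OF measurable_snd measurable_restrict_choice_space])
  then have r: "?r \<in> vertex_law n \<Otimes>\<^sub>M choice_space n \<rightarrow>\<^sub>M count_space (?W \<times> ?W)"
    unfolding pair_measure_countable[OF fin fin] .
  have "?r -` {\<omega> \<in> ?W \<times> ?W. builder_graph m \<omega> \<in> \<P>} \<inter> space (vertex_law n \<Otimes>\<^sub>M choice_space n)
      \<in> sets (vertex_law n \<Otimes>\<^sub>M choice_space n)"
    by (rule measurable_sets[OF r]) auto
  also have "?r -` {\<omega> \<in> ?W \<times> ?W. builder_graph m \<omega> \<in> \<P>} \<inter> space (vertex_law n \<Otimes>\<^sub>M choice_space n) =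
    {\<omega> \<in> space (vertex_law n \<Otimes>\<^sub>M choice_space n). builder_graph m \<omega> \<in> \<P>}"
    using measurable_space[OF r] by (auto simp: builder_graph_restrict[simplified])
  finally show ?thesis .
qed

section \<open>The law of the game under a strategy\<close>

lemma game_kernel:
  assumes "S \<in> offline_strategies n"
  shows "(\<lambda>v. S v \<bind> (\<lambda>u. return (vertex_law n \<Otimes>\<^sub>M choice_space n) (v, u)))
    \<in> vertex_law n \<rightarrow>\<^sub>M prob_algebra (vertex_law n \<Otimes>\<^sub>M choice_space n)"
proof (rule measurable_bind_prob_space2)
  show "S \<in> vertex_law n \<rightarrow>\<^sub>M prob_algebra (choice_space n)"
    using assms by (simp add: offline_strategies_def)
  show "(\<lambda>(v, u). return (vertex_law n \<Otimes>\<^sub>M choice_space n) (v, u))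
    \<in> vertex_law n \<Otimes>\<^sub>M choice_space n \<rightarrow>\<^sub>M prob_algebra (vertex_law n \<Otimes>\<^sub>M choice_space n)"
    by simp
qed

lemma
  assumes "S \<in> offline_strategies n" "n > 0"
  shows prob_space_game_law: "prob_space (game_law n S)"
    and sets_game_law: "sets (game_law n S) = sets (vertex_law n \<Otimes>\<^sub>M choice_space n)"
proof -
  have V: "vertex_law n \<in> space (prob_algebra (vertex_law n))"
    using prob_space_vertex_law[OF assms(2)] by (simp add: space_prob_algebra)
  show "prob_space (game_law n S)"
    unfolding game_law_def by (rule prob_space_bind'[OF V game_kernel[OF assms(1)]])
  show "sets (game_law n S) = sets (vertex_law n \<Otimes>\<^sub>M choice_space n)"
    unfolding game_law_def by (rule sets_bind'[OF V game_kernel[OF assms(1)]])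
qed

text \<open>No strategy can alter the law of the offers: given \<open>v\<close>, all mass sits on
  pairs with first component \<open>v\<close>, and \<open>S v\<close> has total mass one.\<close>

lemma game_law_vertex_event:
  assumes S: "S \<in> offline_strategies n" and "n > 0" and B: "B \<in> sets (vertex_law n)"
  shows "measure (game_law n S) (B \<times> space (choice_space n)) = measure (vertex_law n) B"
proof -
  let ?P = "vertex_law n \<Otimes>\<^sub>M choice_space n"
  let ?K = "\<lambda>v. S v \<bind> (\<lambda>u. return ?P (v, u))"
  have V: "vertex_law n \<in> space (prob_algebra (vertex_law n))"
    using prob_space_vertex_law[OF assms(2)] by (simp add: space_prob_algebra)
  have BC: "B \<times> space (choice_space n) \<in> sets ?P" using B by auto
  have "emeasure (?K v) (B \<times> space (choice_space n)) = indicator B v" if v: "v \<in> space (vertex_law n)" for v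
  proof -
    have Sv: "S v \<in> space (prob_algebra (choice_space n))"
      using S v by (auto simp: offline_strategies_def dest: measurable_space)
    then have sets_Sv: "sets (S v) = sets (choice_space n)" and "prob_space (S v)"
      by (auto simp: space_prob_algebra)
    have space_Sv: "space (S v) = space (choice_space n)" using sets_Sv by (rule sets_eq_imp_space_eq)
    have "(\<lambda>u. return ?P (v, u)) \<in> choice_space n \<rightarrow>\<^sub>M prob_algebra ?P"
      using v by (intro measurable_compose[OF measurable_Pair1' measurable_return_prob_space])
    then have "emeasure (?K v) (B \<times> space (choice_space n)) =
        (\<integral>\<^sup>+u. emeasure (return ?P (v, u)) (B \<times> space (choice_space n)) \<partial>S v)"
      by (intro emeasure_bind_prob_algebra[OF Sv _ BC])
    also have "\<dots> = (\<integral>\<^sup>+u. indicator B v \<partial>S v)"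
      using BC by (intro nn_integral_cong) (auto simp: space_Sv indicator_def)
    also have "\<dots> = indicator B v"
      using \<open>prob_space (S v)\<close> by (simp add: prob_space.emeasure_space_1)
    finally show ?thesis .
  qed
  then have "emeasure (game_law n S) (B \<times> space (choice_space n)) = emeasure (vertex_law n) B"
    unfolding game_law_def using B
    by (subst emeasure_bind_prob_algebra[OF V game_kernel[OF S] BC])
       (simp add: nn_integral_indicator cong: nn_integral_cong)
  then show ?thesis by (simp add: measure_def)
qed

text \<open>The necessary condition depends on \<open>v\<close> alone, so the bound is the same for
  all strategies, randomized or not.\<close>

lemma success_prob_le:
  assumes "S \<in> offline_strategies n" "n > 0"
  shows "success_prob n (min_degree_property k n) S m \<le>
    measure (vertex_law n) {v \<in> space (vertex_law n). deficiency k n (occurrences {1..m} v) \<le> m}"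
    (is "_ \<le> measure _ ?B")
proof -
  interpret prob_space "game_law n S" by (rule prob_space_game_law[OF assms])
  have B: "?B \<in> sets (vertex_law n)" by (rule occurrence_event_measurable)
  have "success_prob n (min_degree_property k n) S m \<le> measure (game_law n S) (?B \<times> space (choice_space n))"
    unfolding success_prob_def
  proof (rule finite_measure_mono)
    show "?B \<times> space (choice_space n) \<in> sets (game_law n S)"
      unfolding sets_game_law[OF assms] using B by auto
    show "{\<omega> \<in> space (game_law n S). builder_graph m \<omega> \<in> min_degree_property k n} \<subseteq> ?B \<times> space (choice_space n)"
      unfolding sets_eq_imp_space_eq[OF sets_game_law[OF assms]]
      by (auto simp: space_pair_measure dest: deficiency_le_rounds)
  qed
  then show ?thesis using game_law_vertex_event[OF assms B] by simp
qed

lemma success_prob_deterministic: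
  assumes "n > 0" and U: "U \<in> vertex_law n \<rightarrow>\<^sub>M choice_space n"
  shows "(\<lambda>v. return (choice_space n) (U v)) \<in> offline_strategies n"
    and "success_prob n \<P> (\<lambda>v. return (choice_space n) (U v)) m =
      measure (vertex_law n) {v \<in> space (vertex_law n). builder_graph m (v, U v) \<in> \<P>}"
proof -
  let ?P = "vertex_law n \<Otimes>\<^sub>M choice_space n"
  show "(\<lambda>v. return (choice_space n) (U v)) \<in> offline_strategies n"
    unfolding offline_strategies_def by (rule measurable_compose[OF U measurable_return_prob_space])
  have graph: "(\<lambda>v. (v, U v)) \<in> vertex_law n \<rightarrow>\<^sub>M ?P"
    by (intro measurable_Pair U) simp
  have "return (choice_space n) (U v) \<bind> (\<lambda>u. return ?P (v, u)) = return ?P (v, U v)"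
    if v: "v \<in> space (vertex_law n)" for v
    using v measurable_space[OF U v]
    by (intro bind_return[where N = ?P] measurable_compose[OF measurable_Pair1' return_measurable])
  then have law: "game_law n (\<lambda>v. return (choice_space n) (U v)) = distr (vertex_law n) ?P (\<lambda>v. (v, U v))"
    unfolding game_law_def bind_return_distr'[OF prob_space.not_empty[OF prob_space_vertex_law[OF assms(1)]] graph, symmetric]
    by (intro bind_cong) auto
  show "success_prob n \<P> (\<lambda>v. return (choice_space n) (U v)) m =
      measure (vertex_law n) {v \<in> space (vertex_law n). builder_graph m (v, U v) \<in> \<P>}"
    unfolding success_prob_def law space_distr measure_distr[OF graph builder_graph_event_measurable]
    using measurable_space[OF graph] by (intro arg_cong[of _ _ "measure (vertex_law n)"]) auto
qed

text \<open>Good answers are selected as a function of the prefix of length \<open>m\<close>. The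
  space of prefixes is discrete, so the selection is measurable and yields a deterministic
  strategy.\<close>

lemma exists_strategy:
  assumes "n > 0" and B: "B \<in> sets (vertex_law n)"
    and ans: "\<And>v. v \<in> B \<Longrightarrow> \<exists>u. (\<forall>t\<in>{1..m}. u t \<in> {1..n}) \<and> builder_graph m (v, u) \<in> \<P>"
  shows "\<exists>S\<in>offline_strategies n. measure (vertex_law n) B \<le> success_prob n \<P> S m"
proof -
  define good where "good w u \<longleftrightarrow> (\<forall>t\<in>{1..m}. u t \<in> {1..n}) \<and> builder_graph m (w, u) \<in> \<P>" for w u
  define g where "g w = (if \<exists>u. good w u then SOME u. good w u else (\<lambda>_. 1))" for w
  \<comment> \<open>The answer \<open>1\<close> after round \<open>m\<close> is an arbitrary legal
    vertex; it does not affect the graph after \<open>m\<close> rounds.\<close>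
  define U where "U v = (\<lambda>t\<in>{1..}. if t \<in> {1..m} then g (restrict v {1..m}) t else 1)" for v
  have g: "good w (g w)" if "good w u" for w u
    using someI[of "good w" u] that by (auto simp: g_def)
  have g_range: "g w t \<in> {1..n}" if "t \<in> {1..m}" for w t
  proof (cases "\<exists>u. good w u")
    case True
    then show ?thesis using g that unfolding good_def by blast
  qed (use assms in \<open>auto simp: g_def\<close>)
  have U: "U \<in> vertex_law n \<rightarrow>\<^sub>M choice_space n"
    unfolding U_def choice_space_def
  proof (rule measurable_restrict)
    fix t :: nat
    have "(\<lambda>w. if t \<in> {1..m} then g w t else 1) \<in> count_space ({1..m} \<rightarrow>\<^sub>E {1..n}) \<rightarrow>\<^sub>M count_space {1..n}"
      using g_range assms by auto
    from measurable_compose[OF measurable_restrict_vertex_law this]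
    show "(\<lambda>v. if t \<in> {1..m} then g (restrict v {1..m}) t else 1) \<in> vertex_law n \<rightarrow>\<^sub>M count_space {1..n}" .
  qed
  have prefix: "builder_graph m (v, U v) = builder_graph m (restrict v {1..m}, g (restrict v {1..m}))" for v
    unfolding builder_graph_def by (auto intro!: image_mset_cong simp: U_def)
  have good_prefix: "good (restrict v {1..m}) u \<longleftrightarrow> good v u" for v u
    unfolding good_def builder_graph_def
    by (intro conj_cong refl arg_cong[of _ _ "\<lambda>G. G \<in> \<P>"]) (auto intro!: image_mset_cong)
  have "B \<subseteq> {v \<in> space (vertex_law n). builder_graph m (v, U v) \<in> \<P>}"
  proof
    fix v assume v: "v \<in> B"
    from ans[OF v] obtain u where "good v u" unfolding good_def by blast
    then have "good (restrict v {1..m}) u" by (simp only: good_prefix)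
    from g[OF this] show "v \<in> {v \<in> space (vertex_law n). builder_graph m (v, U v) \<in> \<P>}"
      using sets.sets_into_space[OF B] v unfolding prefix good_def by auto
  qed
  moreover have "{v \<in> space (vertex_law n). builder_graph m (v, U v) \<in> \<P>} \<in> sets (vertex_law n)"
    unfolding prefix
    using prefix_event_measurable[of n "\<lambda>w. builder_graph m (w, g w) \<in> \<P>" m] .
  ultimately have "measure (vertex_law n) B \<le>
      success_prob n \<P> (\<lambda>v. return (choice_space n) (U v)) m"
    unfolding success_prob_deterministic(2)[OF assms(1) U]
    by (intro finite_measure.finite_measure_mono prob_space.finite_measure prob_space_vertex_law assms(1))
  then show ?thesis
    using success_prob_deterministic(1)[OF assms(1) U] by blast
qed

section \<open>The threshold\<close>

lemma deficiency_concentration: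
  assumes "n > 0" "a > 0"
  shows "measure (vertex_law n) {v \<in> space (vertex_law n).
      a \<le> \<bar>real (deficiency k n (occurrences {1..m} v)) - real n * binomial_deficit (1 / real n) k m\<bar>}
    \<le> real m / a\<^sup>2"
proof -
  have "count_mean n m (\<lambda>d. of_bool (a \<le> \<bar>real (deficiency k n d) - real n * binomial_deficit (1 / real n) k m\<bar>))
     \<le> real m / a\<^sup>2"
    using count_chebyshev[where F = "\<lambda>d. real (deficiency k n d)" and m = m,
        OF assms(1) deficiency_bounded_difference assms(2)]
    unfolding count_mean_deficiency[OF assms(1)] .
  then show ?thesis
    using occurrence_event_prob[OF assms(1),
        of "\<lambda>d. a \<le> \<bar>real (deficiency k n d) - real n * binomial_deficit (1 / real n) k m\<bar>" m] by simp
qed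

lemma tau_offline_ge:
  assumes "\<And>S m. S \<in> offline_strategies n \<Longrightarrow> p \<le> success_prob n (\<P> n) S m \<Longrightarrow> x \<le> real m"
  shows "ereal x \<le> ereal_of_enat (tau_offline p \<P> n)"
proof -
  have "enat (nat \<lceil>x\<rceil>) \<le> tau_offline p \<P> n"
    unfolding tau_offline_def tau_strategy_def
    using assms by (intro INF_greatest Inf_greatest) (auto simp: nat_le_iff ceiling_le_iff)
  then have "ereal_of_enat (enat (nat \<lceil>x\<rceil>)) \<le> ereal_of_enat (tau_offline p \<P> n)"
    by (simp only: ereal_of_enat_le_iff)
  moreover have "ereal x \<le> ereal_of_enat (enat (nat \<lceil>x\<rceil>))"
    by (simp add: real_nat_ceiling_ge)
  ultimately show ?thesis by (rule order_trans[rotated])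
qed

lemma tau_offline_le:
  assumes "S \<in> offline_strategies n" "p \<le> success_prob n (\<P> n) S m" "real m \<le> x"
  shows "ereal_of_enat (tau_offline p \<P> n) \<le> ereal x"
proof -
  have "tau_offline p \<P> n \<le> enat m"
    unfolding tau_offline_def tau_strategy_def
    using assms by (intro INF_lower2[of S] Inf_lower) auto
  then have "ereal_of_enat (tau_offline p \<P> n) \<le> ereal_of_enat (enat m)"
    by (simp only: ereal_of_enat_le_iff)
  then show ?thesis using assms(3) by (simp add: order_trans)
qed

lemma nat_floor_over_tendsto:
  assumes "c > 0"
  shows "(\<lambda>n. real (nat \<lfloor>c * real n\<rfloor>) / real n) \<longlonglongrightarrow> c"
  using assms by real_asymp

text \<open>Error terms of order \<open>1/n\<close> are cut off at \<open>1\<close> to stay in the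
  unit interval required by \<open>whp_tau_offline\<close>.\<close>

lemma truncated_error:
  fixes C :: real
  assumes "C \<ge> 0"
  shows "range (\<lambda>n. min 1 (C / real n)) \<subseteq> {0..1}" "(\<lambda>n. min 1 (C / real n)) \<longlonglongrightarrow> 0"
proof -
  show "range (\<lambda>n. min 1 (C / real n)) \<subseteq> {0..1}" using assms by auto
  have "(\<lambda>n. C / real n) \<longlonglongrightarrow> 0" by real_asymp
  from tendsto_min[OF tendsto_const[of 1] this] show "(\<lambda>n. min 1 (C / real n)) \<longlonglongrightarrow> 0" by simp
qed

lemma tau_offline_lower_bound:
  assumes "k \<ge> 1" "c < alpha k"
  shows "\<exists>\<epsilon> :: nat \<Rightarrow> real. range \<epsilon> \<subseteq> {0..1} \<and> \<epsilon> \<longlonglongrightarrow> 0 \<and>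
    (\<forall>\<^sub>F n in sequentially. ereal (c * real n) \<le> ereal_of_enat (tau_offline (\<epsilon> n) (min_degree_property k) n))"
proof (cases "c \<le> 0")
  case True
  then have "ereal (c * real n) \<le> ereal_of_enat (tau_offline 0 (min_degree_property k) n)" for n
    by (intro tau_offline_ge) (meson mult_nonpos_nonneg of_nat_0_le_iff order_trans)
  then show ?thesis by (intro exI[of _ "\<lambda>_. 0"]) auto
next
  case False
  then have c: "c > 0" by simp
  \<comment> \<open>Half the gap: the mean deficiency will exceed \<open>(c + \<eta>) n\<close>,
    while success within \<open>c n\<close> rounds needs at most \<open>c n\<close>, so it forces a
    deviation of at least \<open>\<eta> n\<close>.\<close>
  define \<eta> where "\<eta> = (poisson_deficit k c - c) / 2"
  \<comment> \<open>The summand \<open>1\<close> makes the final estimate strict, as the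
    contradiction requires.\<close>
  define C where "C = c / \<eta>\<^sup>2 + 1"
  define M where "M n = nat \<lfloor>c * real n\<rfloor>" for n
  have \<eta>: "\<eta> > 0" "c + \<eta> < poisson_deficit k c"
    using poisson_deficit_below_alpha[of k c] assms c by (auto simp: \<eta>_def field_simps)
  have C: "C > 0" using c \<eta> by (auto simp: C_def intro!: add_nonneg_pos)
  have "(\<lambda>n. binomial_deficit (1 / real n) k (M n)) \<longlonglongrightarrow> poisson_deficit k c"
    unfolding M_def using c by (intro binomial_deficit_tendsto nat_floor_over_tendsto)
  then have "\<forall>\<^sub>F n in sequentially. c + \<eta> < binomial_deficit (1 / real n) k (M n)"
    using \<eta>(2) by (rule order_tendstoD)
  then have "\<forall>\<^sub>F n in sequentially. ereal (c * real n) \<le>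
      ereal_of_enat (tau_offline (min 1 (C / real n)) (min_degree_property k) n)"
    using eventually_gt_at_top[of "nat \<lceil>C\<rceil>"]
  proof eventually_elim
    case (elim n)
    then have n: "n > 0" "C / real n < 1" using C by (auto simp: nat_less_iff ceiling_less_iff field_simps)
    interpret V: prob_space "vertex_law n" by (rule prob_space_vertex_law[OF n(1)])
    show ?case
    proof (rule tau_offline_ge, rule ccontr)
      fix S m
      assume S: "S \<in> offline_strategies n" and "\<not> c * real n \<le> real m"
        and success: "min 1 (C / real n) \<le> success_prob n (min_degree_property k n) S m"
      then have mM: "m \<le> M n" by (simp add: M_def le_nat_floor)
      have Mc: "real (M n) \<le> c * real n" using c by (simp add: M_def)
      let ?D = "\<lambda>m v. deficiency k n (occurrences {1..m} v)"
      let ?dev = "{v \<in> space (vertex_law n). \<eta> * real n \<le> \<bar>real (?D (M n) v) - real n * binomial_deficit (1 / real n) k (M n)\<bar>}"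
      have "success_prob n (min_degree_property k n) S m \<le> measure (vertex_law n) {v \<in> space (vertex_law n). ?D m v \<le> m}"
        by (rule success_prob_le[OF S n(1)])
      also have "\<dots> \<le> measure (vertex_law n) ?dev"
      proof (rule V.finite_measure_mono)
        show "?dev \<in> sets (vertex_law n)"
          using occurrence_event_measurable[of n "\<lambda>d. \<eta> * real n \<le> \<bar>real (deficiency k n d) - real n * binomial_deficit (1 / real n) k (M n)\<bar>" "M n"] .
        have "\<eta> * real n \<le> \<bar>real (?D (M n) v) - real n * binomial_deficit (1 / real n) k (M n)\<bar>" if "?D m v \<le> m" for v
        proof -
          have "?D (M n) v \<le> M n"
            using deficiency_occurrences_antimono[OF mM, of k n v] that mM by linarith
          then have "real (?D (M n) v) \<le> c * real n" using Mc by linarith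
          moreover have "(c + \<eta>) * real n \<le> real n * binomial_deficit (1 / real n) k (M n)"
            using elim(1) n(1) by (simp add: mult.commute)
          ultimately show ?thesis by (simp add: distrib_right)
        qed
        then show "{v \<in> space (vertex_law n). ?D m v \<le> m} \<subseteq> ?dev" by blast
      qed
      also have "\<dots> \<le> real (M n) / (\<eta> * real n)\<^sup>2"
        using \<eta>(1) n(1) by (intro deficiency_concentration) auto
      also have "\<dots> \<le> (c * real n) / (\<eta> * real n)\<^sup>2"
        using Mc by (intro divide_right_mono) auto
      also have "\<dots> = (c / \<eta>\<^sup>2) / real n"
        using n(1) by (simp add: power2_eq_square)
      also have "\<dots> < C / real n"
        using n(1) by (intro divide_strict_right_mono) (auto simp: C_def)
      finally show False using success n(2) by simp
    qed
  qed
  then show ?thesis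
    using truncated_error[of C] C by (intro exI[of _ "\<lambda>n. min 1 (C / real n)"]) auto
qed

lemma tau_offline_upper_bound:
  assumes "k \<ge> 1" "alpha k < c"
  shows "\<exists>\<epsilon> :: nat \<Rightarrow> real. range \<epsilon> \<subseteq> {0..1} \<and> \<epsilon> \<longlonglongrightarrow> 0 \<and>
    (\<forall>\<^sub>F n in sequentially. ereal_of_enat (tau_offline (1 - \<epsilon> n) (min_degree_property k) n) \<le> ereal (c * real n))"
proof -
  have c: "c > 0" using alpha_props(1)[OF assms(1)] assms(2) by simp
  \<comment> \<open>The gap is split into four: one part for the limit of the mean, one for the
    deviation, one for the reserve \<open>k * \<Delta>\<close> and one for rounding
    \<open>c n\<close> down to \<open>M n\<close>.\<close>
  define \<eta> where "\<eta> = (c - poisson_deficit k c) / 4"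
  \<comment> \<open>Counts up to \<open>a n\<close> keep the reserve \<open>k * \<Delta>\<close>
    within \<open>\<eta> n\<close>.\<close>
  define a where "a = \<eta> / real k"
  \<comment> \<open>The two terms bound the bad events: Chebyshev for the deficiency and the second
    moment for the largest count.\<close>
  define C where "C = c / \<eta>\<^sup>2 + (c + c\<^sup>2) / a\<^sup>2"
  define M where "M n = nat \<lfloor>c * real n\<rfloor>" for n
  have \<eta>: "\<eta> > 0" using poisson_deficit_above_alpha[OF assms] by (simp add: \<eta>_def)
  have pd: "poisson_deficit k c = c - 4 * \<eta>" by (simp add: \<eta>_def field_simps)
  have a: "a > 0" "real k * a = \<eta>" using \<eta> assms(1) by (auto simp: a_def)
  have C: "C \<ge> 0" using c by (simp add: C_def)
  have "(\<lambda>n. binomial_deficit (1 / real n) k (M n)) \<longlonglongrightarrow> poisson_deficit k c"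
    unfolding M_def using c by (intro binomial_deficit_tendsto nat_floor_over_tendsto)
  then have "\<forall>\<^sub>F n in sequentially. binomial_deficit (1 / real n) k (M n) < c - 3 * \<eta>"
    by (rule order_tendstoD) (use \<eta> pd in simp)
  then have "\<forall>\<^sub>F n in sequentially. ereal_of_enat (tau_offline (1 - min 1 (C / real n)) (min_degree_property k) n)
      \<le> ereal (c * real n)"
    using eventually_gt_at_top[of k] eventually_ge_at_top[of "nat \<lceil>1 / \<eta>\<rceil>"]
  proof eventually_elim
    case (elim n)
    then have n: "n > 0" "k < n" by auto
    have \<eta>n: "1 \<le> \<eta> * real n"
      using elim(3) \<eta> by (simp add: nat_le_iff ceiling_le_iff field_simps)
    interpret V: prob_space "vertex_law n" by (rule prob_space_vertex_law[OF n(1)])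
    have Mc: "real (M n) \<le> c * real n" "c * real n - 1 \<le> real (M n)"
      using c by (auto simp: M_def)
    let ?D = "\<lambda>v. deficiency k n (occurrences {1..M n} v)"
    let ?dev = "{v \<in> space (vertex_law n). \<eta> * real n \<le> \<bar>real (?D v) - real n * binomial_deficit (1 / real n) k (M n)\<bar>}"
    let ?large = "{v \<in> space (vertex_law n). \<exists>x\<in>{1..n}. a * real n < real (occurrences {1..M n} v x)}"
    have dev: "?dev \<in> sets (vertex_law n)"
      using occurrence_event_measurable[of n "\<lambda>d. \<eta> * real n \<le> \<bar>real (deficiency k n d) - real n * binomial_deficit (1 / real n) k (M n)\<bar>" "M n"] .
    have large: "?large \<in> sets (vertex_law n)"
      using occurrence_event_measurable[of n "\<lambda>d. \<exists>x\<in>{1..n}. a * real n < real (d x)" "M n"] .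
    have "measure (vertex_law n) ?dev \<le> real (M n) / (\<eta> * real n)\<^sup>2"
      using \<eta> n(1) by (intro deficiency_concentration) auto
    also have "\<dots> \<le> (c * real n) / (\<eta> * real n)\<^sup>2"
      using Mc by (intro divide_right_mono) auto
    also have "\<dots> = (c / \<eta>\<^sup>2) / real n"
      using n(1) by (simp add: power2_eq_square)
    finally have dev_prob: "measure (vertex_law n) ?dev \<le> (c / \<eta>\<^sup>2) / real n" .
    have Mn: "real (M n) / real n \<le> c" using Mc(1) n(1) by (simp add: divide_le_eq)
    have "measure (vertex_law n) ?large = count_mean n (M n) (\<lambda>d. of_bool (\<exists>x\<in>{1..n}. a * real n < real (d x)))"
      using occurrence_event_prob[OF n(1), of "\<lambda>d. \<exists>x\<in>{1..n}. a * real n < real (d x)" "M n"] .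
    also have "\<dots> \<le> real n * (real (M n) / real n + (real (M n) / real n)\<^sup>2) / (a * real n)\<^sup>2"
      using a n(1) by (intro count_large_occurrence) auto
    also have "\<dots> \<le> real n * (c + c\<^sup>2) / (a * real n)\<^sup>2"
      using Mn by (intro divide_right_mono mult_left_mono add_mono power_mono) auto
    also have "\<dots> = ((c + c\<^sup>2) / a\<^sup>2) / real n"
      using n(1) by (simp add: power2_eq_square)
    finally have large_prob: "measure (vertex_law n) ?large \<le> ((c + c\<^sup>2) / a\<^sup>2) / real n" .
    have "measure (vertex_law n) (?dev \<union> ?large) \<le> measure (vertex_law n) ?dev + measure (vertex_law n) ?large"
      by (rule measure_Un_le[OF dev large])
    also have "\<dots> \<le> C / real n"
      using dev_prob large_prob by (simp add: C_def add_divide_distrib)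
    finally have bad: "measure (vertex_law n) (?dev \<union> ?large) \<le> C / real n" .
    let ?good = "space (vertex_law n) - (?dev \<union> ?large)"
    have "\<exists>S\<in>offline_strategies n. measure (vertex_law n) ?good \<le> success_prob n (min_degree_property k n) S (M n)"
    proof (rule exists_strategy[OF n(1)])
      show "?good \<in> sets (vertex_law n)" using dev large by auto
      fix v assume v: "v \<in> ?good"
      define \<Delta> where "\<Delta> = nat \<lfloor>a * real n\<rfloor>"
      show "\<exists>u. (\<forall>t\<in>{1..M n}. u t \<in> {1..n}) \<and> builder_graph (M n) (v, u) \<in> min_degree_property k n"
      proof (rule exists_answers)
        show "v t \<in> {1..n}" if "t \<in> {1..M n}" for t
          using v that by (auto simp: vertex_law_def space_PiM space_uniform_count_measure PiE_iff)
        show "occurrences {1..M n} v x \<le> \<Delta>" if "x \<in> {1..n}" for x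
          using v that unfolding \<Delta>_def by (intro le_nat_floor) (auto simp: not_less)
        have "\<bar>real (?D v) - real n * binomial_deficit (1 / real n) k (M n)\<bar> < \<eta> * real n"
          using v by auto
        moreover have "real n * binomial_deficit (1 / real n) k (M n) \<le> (c - 3 * \<eta>) * real n"
          using elim(1) by (simp add: mult.commute mult_left_mono)
        ultimately have D: "real (?D v) \<le> (c - 2 * \<eta>) * real n" by (simp add: algebra_simps)
        have "real \<Delta> \<le> a * real n" using a by (simp add: \<Delta>_def)
        then have "real k * real \<Delta> \<le> real k * (a * real n)" by (intro mult_left_mono) auto
        also have "\<dots> = \<eta> * real n" using a(2) by (simp add: mult.assoc[symmetric])
        finally have "real (?D v + k * \<Delta>) \<le> real (M n)"
          using D \<eta>n Mc(2) by (simp add: algebra_simps)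
        then show "?D v + k * \<Delta> \<le> M n" by (simp only: of_nat_le_iff)
      qed (rule n(2))
    qed
    then obtain S where S: "S \<in> offline_strategies n"
      "measure (vertex_law n) ?good \<le> success_prob n (min_degree_property k n) S (M n)" by blast
    have "measure (vertex_law n) ?good = 1 - measure (vertex_law n) (?dev \<union> ?large)"
      using dev large by (intro V.prob_compl) auto
    \<comment> \<open>Nonnegativity covers the case where the error term is cut off at
      \<open>1\<close>.\<close>
    moreover have "0 \<le> measure (vertex_law n) ?good" by simp
    ultimately have "1 - min 1 (C / real n) \<le> success_prob n (min_degree_property k n) S (M n)"
      using S(2) bad by linarith
    then show ?case using S(1) Mc(1) by (intro tau_offline_le[where S = S and m = "M n"]) auto
  qed
  then show ?thesis
    using truncated_error[OF C] by (intro exI[of _ "\<lambda>n. min 1 (C / real n)"]) auto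
qed

text \<open>Unique existence ensures that the definite description in \<open>alpha\<close> denotes
  the root.\<close>

theorem theorem1p9:
  fixes k :: nat
  assumes "k \<ge> 1"
  shows "(\<exists>!x. x > 0 \<and> f_root k x = 0) \<and> whp_tau_offline (min_degree_property k) (alpha k)"
  using ex1_f_root[OF assms] tau_offline_upper_bound[OF assms] tau_offline_lower_bound[OF assms]
  by (simp add: whp_tau_offline_def)

end
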